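(* Let $S, J\subset \mathbb{R}$ be intervals such that $0\in S$ and $1\in J$. If the mapping $\eta\colon J\times S\to S$ is multiplicatively translational and there exists $s^{\ast}\in S$ such that the mapping $$J\ni \lambda \mapsto \eta(\lambda, s^{\ast})\in S$$ is bijective, then there exists a bijective function $H\colon J\to S$ with $H(0)=0$ such that $$\eta(\lambda, s)= H(\lambda\cdot H^{-1}(s))\qquad (\lambda\in J,\ s\in S).$$
   Context: Every interval has positive length. For intervals $S,J\subset\mathbb{R}$ with $0\in S$ and $1\in J$, a mapping $\eta\colon J\times S\to S$ is called multiplicatively translational if $\eta(\lambda\tilde{\lambda}, s)= \eta(\tilde{\lambda}, \eta(\lambda, s))$ and also the boundary conditions $\eta(\lambda, 0)=0$ and $\eta(1, s)=s$ hold for all $\lambda, \tilde{\lambda}\in J$ and $s\in S$ (in particular it is implicit that $\lambda\tilde\lambda\in J$ for $\lambda,\tilde\lambda\in J$). *)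

theory Defs
  imports "HOL-Analysis.Analysis"
begin

definition nondegenerate_interval :: "real set \<Rightarrow> bool" where
  "nondegenerate_interval I \<longleftrightarrow> is_interval I \<and> (\<exists>a\<in>I. \<exists>b\<in>I. a < b)"

text \<open>
  Closure of \<open>J\<close> under multiplication is part of the notion: otherwise the
  left-hand side of the translation equation would be evaluated outside the domain
  \<open>J \<times> S\<close> of \<open>\<eta>\<close>.
\<close>

definition mult_translational ::
    "real set \<Rightarrow> real set \<Rightarrow> (real \<times> real \<Rightarrow> real) \<Rightarrow> bool" where
  "mult_translational J S \<eta> \<longleftrightarrow>
     \<eta> \<in> J \<times> S \<rightarrow> S \<and>
     (\<forall>l\<in>J. \<forall>l'\<in>J. l * l' \<in> J) \<and>
     (\<forall>l\<in>J. \<forall>l'\<in>J. \<forall>s\<in>S. \<eta> (l * l', s) = \<eta> (l', \<eta> (l, s))) \<and>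
     (\<forall>l\<in>J. \<eta> (l, 0) = 0) \<and>
     (\<forall>s\<in>S. \<eta> (1, s) = s)"

end

theory Submission
  imports Defs
begin

text \<open>
  The function \<open>H\<close> is the orbit map \<open>l \<mapsto> \<eta> (l, s0)\<close> of the distinguished point, and the
  translation equation says that \<open>\<eta>\<close> acts on the orbit by multiplication of the parameters:
  \<open>\<eta> (l, H m) = H (l * m)\<close>. As \<open>H\<close> maps onto \<open>S\<close>, this determines \<open>\<eta>\<close> everywhere.

  It remains to see that \<open>H\<close> vanishes exactly at \<open>0\<close>. Since \<open>0\<close> is a fixed point of the action,
  its \<open>H\<close>-preimage is fixed under multiplication by every element of \<open>J\<close>; as \<open>J\<close> contains an
  element other than \<open>1\<close>, only the number \<open>0\<close> has this property, which also yields \<open>0 \<in> J\<close>.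
\<close>

theorem lemma3:
  fixes S J :: "real set" and \<eta> :: "real \<times> real \<Rightarrow> real"
  assumes "nondegenerate_interval S" and "nondegenerate_interval J"
    and "0 \<in> S" and "1 \<in> J"
    and "mult_translational J S \<eta>"
    and "\<exists>s0\<in>S. bij_betw (\<lambda>l. \<eta> (l, s0)) J S"
  shows "\<exists>H. bij_betw H J S \<and> 0 \<in> J \<and> H 0 = 0 \<and>
           (\<forall>l\<in>J. \<forall>s\<in>S. \<eta> (l, s) = H (l * inv_into J H s))"
proof -
  obtain s0 where s0: "s0 \<in> S" and bij0: "bij_betw (\<lambda>l. \<eta> (l, s0)) J S"
    using assms(6) by blast
  define H where "H = (\<lambda>l. \<eta> (l, s0))"
  have bij: "bij_betw H J S"
    using bij0 by (simp add: H_def)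
  have closed: "l * m \<in> J" if "l \<in> J" "m \<in> J" for l m
    using assms(5) that by (simp add: mult_translational_def)
  have fix0: "\<eta> (l, 0) = 0" if "l \<in> J" for l
    using assms(5) that by (simp add: mult_translational_def)
  have act: "\<eta> (l, H m) = H (l * m)" if "l \<in> J" "m \<in> J" for l m
  proof -
    have "\<eta> (m * l, s0) = \<eta> (l, \<eta> (m, s0))"
      using assms(5) s0 that by (simp add: mult_translational_def)
    then show ?thesis
      by (simp add: H_def mult.commute)
  qed
  obtain m where m: "m \<in> J" "H m = 0"
    using bij assms(3) by (auto simp: bij_betw_def)
  obtain l where l: "l \<in> J" "l \<noteq> 1"
    using assms(2) by (auto simp: nondegenerate_interval_def)
  have "H (l * m) = H m"
    using act[OF l(1) m(1)] fix0[OF l(1)] m(2) by simp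
  then have "l * m = m"
    using bij closed l(1) m(1) by (auto simp: bij_betw_def dest: inj_onD)
  then have "m = 0"
    using l(2) by simp
  moreover have "\<eta> (l, s) = H (l * inv_into J H s)" if "l \<in> J" "s \<in> S" for l s
  proof -
    have "s \<in> H ` J"
      using bij that(2) by (simp add: bij_betw_def)
    then show ?thesis
      using act[OF that(1) inv_into_into[of s H J]] by (simp add: f_inv_into_f)
  qed
  ultimately show ?thesis
    using bij m by blast
qed

end
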